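(* Let $NK$ denote the Narumi-Katayama index of a tree, and write $NK(n)=NK(\tau(n))$, where $\tau(n)$ is the rooted tree with Matula number $n$. Then for every positive integer $n$, $$NK(n)=\begin{cases}0, & \text{if } n=1;\\ 1, & \text{if } n=2;\\ NK(t)\left(1+\frac{1}{\Omega(t)}\right), & \text{if } n=p_t \text{ with } t\ge 2;\\ NK(r)NK(s)\left(\frac{1}{\Omega(r)}+\frac{1}{\Omega(s)}\right), & \text{if } n=rs \text{ with } r,s\ge 2.\end{cases}$$
   Context: For $m\ge 1$ let $p_m$ denote the $m$-th prime ($p_1=2,p_2=3,p_3=5,\dots$). For a positive integer $n$, $\Omega(n)$ is the number of prime divisors of $n$ counted with multiplicity. Rooted trees are finite and considered up to isomorphism of rooted trees. The Matula number $\mu(T)$ of a rooted tree $T$ is defined recursively: $\mu(T)=1$ for the one-vertex tree; otherwise, if $T_1,\dots,T_d$ are the subtrees rooted at the vertices adjacent to the root of $T$, then $\mu(T)=p_{\mu(T_1)}p_{\mu(T_2)}\cdots p_{\mu(T_d)}$. The map $\mu$ is a bijection from rooted trees to positive integers, and $\tau(n)$ denotes the rooted tree with Matula number $n$. Equivalently: $\tau(1)$ is the one-vertex tree; $\tau(p_t)$ is obtained from $\tau(t)$ by adding a new vertex, which becomes the root, joined by an edge to the root of $\tau(t)$; and, for $r,s\ge 2$, $\tau(rs)$ is obtained from $\tau(r)$ and $\tau(s)$ by identifying their roots. For a statistic $S$ on rooted trees, $S(n)$ means $S(\tau(n))$. The degree $\deg(i)$ of a vertex $i$ is the number of edges incident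 with $i$. The Narumi-Katayama index of a tree is $\prod_i \deg(i)$, the product being over all vertices $i$. *)

theory Defs
  imports Complex_Main "HOL-Library.Infinite_Set" "HOL-Computational_Algebra.Primes"
begin

record 'a rooted_graph =
  verts :: "'a set"
  edges :: "'a set set"
  root_vertex :: 'a

definition simple_graph :: "'a rooted_graph \<Rightarrow> bool" where
  "simple_graph G \<longleftrightarrow> finite (verts G) \<and> (\<forall>e\<in>edges G. e \<subseteq> verts G \<and> card e = 2)"

definition adjacency :: "'a set set \<Rightarrow> ('a \<times> 'a) set" where
  "adjacency E = {(u, v). {u, v} \<in> E}"

definition connected_graph :: "'a rooted_graph \<Rightarrow> bool" where
  "connected_graph G \<longleftrightarrow> (\<forall>u\<in>verts G. \<forall>v\<in>verts G. (u, v) \<in> (adjacency (edges G))\<^sup>*)"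

definition is_cycle :: "'a rooted_graph \<Rightarrow> 'a list \<Rightarrow> bool" where
  "is_cycle G vs \<longleftrightarrow> length vs \<ge> 3 \<and> distinct vs \<and>
     (\<forall>i < length vs. {vs ! i, vs ! (Suc i mod length vs)} \<in> edges G)"

definition rooted_tree :: "'a rooted_graph \<Rightarrow> bool" where
  "rooted_tree T \<longleftrightarrow> simple_graph T \<and> root_vertex T \<in> verts T \<and>
     connected_graph T \<and> \<not> (\<exists>vs. is_cycle T vs)"

definition neighbours :: "'a rooted_graph \<Rightarrow> 'a \<Rightarrow> 'a set" where
  "neighbours G v = {w. {v, w} \<in> edges G}"

text \<open>The subtree of \<open>T\<close> rooted at a neighbour \<open>v\<close> of the root: the connected component
  of \<open>v\<close> after deleting the root vertex.\<close>

definition branch :: "'a rooted_graph \<Rightarrow> 'a \<Rightarrow> 'a rooted_graph" where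
  "branch T v =
    (let E = {e \<in> edges T. root_vertex T \<notin> e};
         W = {w. (v, w) \<in> (adjacency E)\<^sup>*}
     in \<lparr>verts = W, edges = {e \<in> E. e \<subseteq> W}, root_vertex = v\<rparr>)"

lemma card_branch_less:
  assumes T: "rooted_tree T" and v: "v \<in> neighbours T (root_vertex T)"
  shows "card (verts (branch T v)) < card (verts T)"
proof -
  let ?r = "root_vertex T"
  let ?E = "{e \<in> edges T. ?r \<notin> e}"
  have fin: "finite (verts T)" and sub: "\<And>e. e \<in> edges T \<Longrightarrow> e \<subseteq> verts T \<and> card e = 2"
    and r: "?r \<in> verts T"
    using T by (auto simp: rooted_tree_def simple_graph_def)
  have e: "{?r, v} \<in> edges T"
    using v by (simp add: neighbours_def)
  have v': "v \<in> verts T - {?r}"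
    using sub[OF e] by (cases "v = ?r") auto
  have "w \<in> verts T - {?r}" if "(v, w) \<in> (adjacency ?E)\<^sup>*" for w
    using that
  proof (induction rule: rtrancl_induct)
    case base
    show ?case by (rule v')
  next
    case (step y z)
    then have "{y, z} \<in> edges T" "?r \<notin> {y, z}"
      by (auto simp: adjacency_def)
    then show ?case
      using sub by fastforce
  qed
  then have "verts (branch T v) \<subseteq> verts T - {?r}"
    by (auto simp: branch_def Let_def)
  then have "verts (branch T v) \<subset> verts T"
    using r by auto
  then show ?thesis
    using fin by (rule psubset_card_mono[rotated])
qed

text \<open>The \<open>m\<close>-th prime, with indices starting at 1; \<^const>\<open>enumerate\<close> starts at 0.\<close>

definition nth_prime :: "nat \<Rightarrow> nat" where
  "nth_prime m = enumerate {q. prime q} (m - 1)"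

definition big_omega :: "nat \<Rightarrow> nat" where
  "big_omega n = size (prime_factorization n)"

text \<open>For the one-vertex tree the product is empty, so the Matula number is 1.
  The value 0 marks arguments that are not rooted trees.\<close>

function matula :: "'a rooted_graph \<Rightarrow> nat" where
  "matula T =
    (if rooted_tree T
     then \<Prod>v\<in>neighbours T (root_vertex T). nth_prime (matula (branch T v))
     else 0)"
  by pat_completeness auto
termination
  by (relation "measure (\<lambda>T. card (verts T))") (auto intro: card_branch_less)

declare matula.simps [simp del]

text \<open>The rooted tree with Matula number \<open>n \<ge> 1\<close> exists and is unique up to isomorphism;
  \<open>tau n\<close> is a representative of its isomorphism class on vertices of type \<^typ>\<open>nat\<close>.\<close>

definition tau :: "nat \<Rightarrow> nat rooted_graph" where
  "tau n = (SOME T. rooted_tree T \<and> matula T = n)"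

definition degree :: "'a rooted_graph \<Rightarrow> 'a \<Rightarrow> nat" where
  "degree G v = card {e \<in> edges G. v \<in> e}"

definition narumi_katayama :: "'a rooted_graph \<Rightarrow> nat" where
  "narumi_katayama G = (\<Prod>v\<in>verts G. degree G v)"

definition NK :: "nat \<Rightarrow> nat" where
  "NK n = narumi_katayama (tau n)"

end

theory Submission
  imports Defs
begin

text \<open>
  The index of a rooted tree \<open>T\<close> splits as the degree of the root times the product of
  the degrees of all other vertices, and both factors are arithmetic functions of the Matula number
  \<open>n\<close> of \<open>T\<close>.

  Each branch at the root contributes one prime factor to \<open>n\<close>, so the degree of the
  root is \<open>\<Omega>(n)\<close>. Call the product over the other vertices \<open>P(n)\<close>. It is a
  product over the branches. In a branch with Matula number \<open>t\<close> all degrees are the same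
  as in \<open>T\<close>, except that the root of the branch has one more edge in \<open>T\<close>, the one
  to the root of \<open>T\<close>; so this branch contributes \<open>P(t) (\<Omega>(t) + 1)\<close>. Hence
  \<open>P\<close> is the completely multiplicative function with
  \<open>P(p\<^sub>t) = P(t) (\<Omega>(t) + 1)\<close> (\<open>nonroot_product\<close>, with
  \<open>prod_degree_nonroot\<close>), and the index is \<open>\<Omega>(n) P(n)\<close>
  (\<open>narumi_katayama_eq\<close>). The four cases of the recursion now follow from
  \<open>\<Omega>(1) = 0\<close>, \<open>\<Omega>(p\<^sub>t) = 1\<close> and
  \<open>\<Omega>(rs) = \<Omega>(r) + \<Omega>(s)\<close>.

  Since this formula depends on \<open>T\<close> through its Matula number alone, the choice made by
  \<^const>\<open>tau\<close> is harmless, and trees need not be compared up to isomorphism. It remains to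
  show that a tree with Matula number \<open>n\<close> exists (\<open>rooted_tree_with_matula_exists\<close>):
  write \<open>n = p\<^sub>t m\<close> and hang a tree for \<open>t\<close> below the root of a tree for
  \<open>m\<close>.

  The geometric input, that the branches partition the non-root vertices and that hanging one tree
  below another creates no cycle, is obtained by reading acyclicity as the statement that every edge
  is a bridge (\<open>rooted_tree_iff\<close>); reachability is then handled by rule induction instead of
  by manipulating vertex lists.
\<close>

section \<open>Cycles and reachability\<close>

lemma in_adjacency: "(x, y) \<in> adjacency E \<longleftrightarrow> {x, y} \<in> E"
  by (simp add: adjacency_def)

lemma adjacency_mono: "E \<subseteq> F \<Longrightarrow> (adjacency E)\<^sup>* \<subseteq> (adjacency F)\<^sup>*"
  by (rule rtrancl_mono) (auto simp: in_adjacency)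

lemma reachable_sym: "(x, y) \<in> (adjacency E)\<^sup>* \<Longrightarrow> (y, x) \<in> (adjacency E)\<^sup>*"
  by (rule symD[OF sym_rtrancl]) (auto intro: symI simp: in_adjacency insert_commute)

text \<open>When a path is extended by a vertex that it has already visited, cutting it off at the
  first visit keeps it free of repetitions.\<close>

lemma reachable_imp_distinct_path:
  assumes "(u, v) \<in> R\<^sup>*"
  shows "\<exists>xs. xs \<noteq> [] \<and> hd xs = u \<and> last xs = v \<and> distinct xs \<and>
    successively (\<lambda>x y. (x, y) \<in> R) xs"
  using assms
proof (induction rule: rtrancl_induct)
  case base
  show ?case by (rule exI[of _ "[u]"]) simp
next
  case (step y z)
  then obtain xs where xs: "xs \<noteq> []" "hd xs = u" "last xs = y" "distinct xs"
    "successively (\<lambda>x y. (x, y) \<in> R) xs"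
    by blast
  show ?case
  proof (cases "z \<in> set xs")
    case True
    then obtain ys zs where "xs = ys @ z # zs"
      by (meson split_list)
    with xs show ?thesis
      by (intro exI[of _ "ys @ [z]"])
        (cases ys; auto simp: successively_append_iff successively_Cons hd_append)
  next
    case False
    with xs step.hyps show ?thesis
      by (intro exI[of _ "xs @ [z]"]) (auto simp: successively_append_iff)
  qed
qed

text \<open>Removing an edge from a cycle leaves a path between its ends. Conversely a
  repetition-free path that avoids an edge between its ends has at least three vertices, and the
  edge closes it to a cycle.\<close>

lemma has_cycle_iff:
  assumes "\<forall>e\<in>edges G. card e = 2"
  shows "(\<exists>vs. is_cycle G vs) \<longleftrightarrow>
    (\<exists>u v. {u, v} \<in> edges G \<and> (u, v) \<in> (adjacency (edges G - {{u, v}}))\<^sup>*)"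
proof
  assume "\<exists>vs. is_cycle G vs"
  then obtain vs where len: "length vs \<ge> 3" and dist: "distinct vs"
    and edge: "\<And>i. i < length vs \<Longrightarrow> {vs ! i, vs ! (Suc i mod length vs)} \<in> edges G"
    by (auto simp: is_cycle_def)
  define k where "k = length vs - 1"
  have k: "k \<ge> 2" "length vs = Suc k"
    using len by (auto simp: k_def)
  have path: "(vs ! 0, vs ! i) \<in> (adjacency (edges G - {{vs ! 0, vs ! k}}))\<^sup>*" if "i \<le> k" for i
    using that
  proof (induction i)
    case 0
    show ?case by simp
  next
    case (Suc i)
    \<comment> \<open>A consecutive pair equal to the closing edge would force \<open>k = 1\<close>, a cycle of length 2.\<close>
    have "{vs ! i, vs ! Suc i} \<noteq> {vs ! 0, vs ! k}"
      using Suc.prems k dist by (auto simp: doubleton_eq_iff nth_eq_iff_index_eq)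
    moreover have "{vs ! i, vs ! Suc i} \<in> edges G"
      using edge[of i] Suc.prems k by simp
    ultimately have "(vs ! i, vs ! Suc i) \<in> adjacency (edges G - {{vs ! 0, vs ! k}})"
      by (simp add: in_adjacency)
    with Suc show ?case
      by (auto intro: rtrancl_into_rtrancl)
  qed
  have "{vs ! 0, vs ! k} \<in> edges G"
    using edge[of k] k by (simp add: insert_commute)
  with path[of k] show "\<exists>u v. {u, v} \<in> edges G \<and> (u, v) \<in> (adjacency (edges G - {{u, v}}))\<^sup>*"
    by blast
next
  assume "\<exists>u v. {u, v} \<in> edges G \<and> (u, v) \<in> (adjacency (edges G - {{u, v}}))\<^sup>*"
  then obtain u v where uv: "{u, v} \<in> edges G"
    and reach: "(u, v) \<in> (adjacency (edges G - {{u, v}}))\<^sup>*"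
    by blast
  have "u \<noteq> v"
    using assms uv by force
  obtain xs where xs: "xs \<noteq> []" "hd xs = u" "last xs = v" "distinct xs"
    "successively (\<lambda>x y. (x, y) \<in> adjacency (edges G - {{u, v}})) xs"
    using reachable_imp_distinct_path[OF reach] by blast
  have "length xs \<noteq> Suc 0" "length xs \<noteq> Suc (Suc 0)"
    using xs \<open>u \<noteq> v\<close> by (auto simp: length_Suc_conv in_adjacency)
  with xs(1) have len: "length xs \<ge> 3"
    by (cases "length xs") auto
  have "{xs ! i, xs ! (Suc i mod length xs)} \<in> edges G" if "i < length xs" for i
  proof (cases "Suc i < length xs")
    case True
    then show ?thesis
      using xs(5) by (auto simp: successively_conv_nth in_adjacency)
  next
    case False
    then have "Suc i = length xs"
      using that by simp
    then have "xs ! i = v"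
      using xs by (metis diff_Suc_1 last_conv_nth)
    then show ?thesis
      using \<open>Suc i = length xs\<close> xs uv by (simp add: hd_conv_nth insert_commute)
  qed
  then show "\<exists>vs. is_cycle G vs"
    using len xs(4) by (auto simp: is_cycle_def)
qed

lemma rooted_tree_iff:
  "rooted_tree T \<longleftrightarrow> simple_graph T \<and> root_vertex T \<in> verts T \<and> connected_graph T \<and>
    (\<forall>u v. {u, v} \<in> edges T \<longrightarrow> (u, v) \<notin> (adjacency (edges T - {{u, v}}))\<^sup>*)"
  using has_cycle_iff[of T] by (auto simp: rooted_tree_def simple_graph_def)

text \<open>No edge of \<open>F\<close> touches \<open>V\<close>, so a walk that starts in \<open>V\<close> never gets to
  use one.\<close>

lemma reachable_Un_disjoint:
  assumes "(x, y) \<in> (adjacency (E \<union> F))\<^sup>*" "x \<in> V"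
    and "\<And>e. e \<in> E \<Longrightarrow> e \<subseteq> V" "\<And>e. e \<in> F \<Longrightarrow> e \<inter> V = {}"
  shows "y \<in> V \<and> (x, y) \<in> (adjacency E)\<^sup>*"
  using assms(1)
proof (induction rule: rtrancl_induct)
  case base
  show ?case using assms(2) by simp
next
  case (step y z)
  then have "{y, z} \<in> E"
    using assms(4)[of "{y, z}"] by (auto simp: in_adjacency)
  then show ?case
    using step.IH assms(3)[of "{y, z}"] by (auto intro: rtrancl_into_rtrancl simp: in_adjacency)
qed

section \<open>Decomposition of a rooted tree into its branches\<close>

lemma verts_branch:
  "verts (branch T v) = {w. (v, w) \<in> (adjacency {e \<in> edges T. root_vertex T \<notin> e})\<^sup>*}"
  by (simp add: branch_def Let_def)

lemma edges_branch:
  "edges (branch T v) = {e \<in> edges T. root_vertex T \<notin> e \<and> e \<subseteq> verts (branch T v)}"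
  by (auto simp: branch_def Let_def)

lemma root_branch [simp]: "root_vertex (branch T v) = v"
  by (simp add: branch_def Let_def)

lemma root_in_branch: "v \<in> verts (branch T v)"
  by (simp add: verts_branch)

lemma branch_closed:
  assumes "w \<in> verts (branch T v)" "{w, x} \<in> edges T" "root_vertex T \<notin> {w, x}"
  shows "x \<in> verts (branch T v)"
  using assms by (auto simp: verts_branch in_adjacency intro: rtrancl_into_rtrancl)

context
  fixes T :: "'a rooted_graph"
  assumes tree: "rooted_tree T"
begin

lemma tree_edge: "e \<in> edges T \<Longrightarrow> e \<subseteq> verts T \<and> card e = 2"
  using tree by (auto simp: rooted_tree_iff simple_graph_def)

lemma tree_edge_at: "e \<in> edges T \<Longrightarrow> w \<in> e \<Longrightarrow> \<exists>x. e = {w, x}"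
  using tree_edge[of e] by (auto simp: card_2_iff)

lemma neighbours_root_subset: "neighbours T (root_vertex T) \<subseteq> verts T - {root_vertex T}"
  using tree_edge by (fastforce simp: neighbours_def)

lemma finite_neighbours_root: "finite (neighbours T (root_vertex T))"
  using neighbours_root_subset tree finite_subset
  by (fastforce simp: rooted_tree_iff simple_graph_def)

lemma verts_branch_subset:
  assumes "v \<in> neighbours T (root_vertex T)"
  shows "verts (branch T v) \<subseteq> verts T - {root_vertex T}"
proof
  fix w
  assume "w \<in> verts (branch T v)"
  then have "(v, w) \<in> (adjacency {e \<in> edges T. root_vertex T \<notin> e})\<^sup>*"
    by (simp add: verts_branch)
  then show "w \<in> verts T - {root_vertex T}"
  proof (induction rule: rtrancl_induct)
    case base
    show ?case using assms neighbours_root_subset by blast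
  next
    case (step y z)
    then show ?case using tree_edge[of "{y, z}"] by (auto simp: in_adjacency)
  qed
qed

lemma finite_verts_branch:
  "v \<in> neighbours T (root_vertex T) \<Longrightarrow> finite (verts (branch T v))"
  using verts_branch_subset tree finite_subset
  by (fastforce simp: rooted_tree_iff simple_graph_def)

text \<open>A walk from \<open>v\<close> that avoids the root stays among the vertices reached this way,
  so it uses only edges of the branch; this gives connectedness. Bridges of \<open>T\<close> remain bridges
  in any smaller edge set.\<close>

lemma rooted_tree_branch:
  assumes "v \<in> neighbours T (root_vertex T)"
  shows "rooted_tree (branch T v)"
proof -
  have from_root: "(v, w) \<in> (adjacency (edges (branch T v)))\<^sup>*" if "w \<in> verts (branch T v)" for w
  proof -
    have "(v, w) \<in> (adjacency {e \<in> edges T. root_vertex T \<notin> e})\<^sup>*"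
      using that by (simp add: verts_branch)
    then show ?thesis
    proof (induction rule: rtrancl_induct)
      case base
      show ?case by simp
    next
      case (step y z)
      then have "y \<in> verts (branch T v)" "z \<in> verts (branch T v)"
        by (auto simp: verts_branch intro: rtrancl_into_rtrancl)
      then have "(y, z) \<in> adjacency (edges (branch T v))"
        using step.hyps(2) by (auto simp: in_adjacency edges_branch)
      with step.IH show ?case by (rule rtrancl_into_rtrancl)
    qed
  qed
  have "connected_graph (branch T v)"
    unfolding connected_graph_def
    using from_root reachable_sym rtrancl_trans by meson
  moreover have "simple_graph (branch T v)"
    using finite_verts_branch[OF assms] tree_edge by (auto simp: simple_graph_def edges_branch)
  moreover have "(x, y) \<notin> (adjacency (edges (branch T v) - {{x, y}}))\<^sup>*"
    if "{x, y} \<in> edges (branch T v)" for x y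
  proof -
    have "edges (branch T v) - {{x, y}} \<subseteq> edges T - {{x, y}}"
      by (auto simp: edges_branch)
    moreover have "(x, y) \<notin> (adjacency (edges T - {{x, y}}))\<^sup>*"
      using that tree by (simp add: rooted_tree_iff edges_branch)
    ultimately show ?thesis
      using adjacency_mono by blast
  qed
  ultimately show ?thesis
    by (simp add: rooted_tree_iff root_in_branch)
qed

text \<open>Follow a walk from the root: whenever it leaves the root it enters a branch, and it can
  leave that branch only through the root.\<close>

lemma verts_eq_Union_branches:
  "verts T - {root_vertex T} = (\<Union>v\<in>neighbours T (root_vertex T). verts (branch T v))"
proof
  have "w = root_vertex T \<or> (\<exists>v\<in>neighbours T (root_vertex T). w \<in> verts (branch T v))"
    if "(root_vertex T, w) \<in> (adjacency (edges T))\<^sup>*" for w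
    using that
  proof (induction rule: rtrancl_induct)
    case base
    show ?case by simp
  next
    case (step y z)
    then show ?case
      using branch_closed[of y T _ z] root_in_branch[of z T]
      by (auto simp: in_adjacency neighbours_def)
  qed
  then show "verts T - {root_vertex T} \<subseteq> (\<Union>v\<in>neighbours T (root_vertex T). verts (branch T v))"
    using tree by (auto simp: rooted_tree_iff connected_graph_def)
qed (use verts_branch_subset in blast)

text \<open>If two branches met, the root could reach \<open>v'\<close> through \<open>v\<close>, so its edge to
  \<open>v'\<close> would not be a bridge.\<close>

lemma branches_disjoint:
  assumes v: "v \<in> neighbours T (root_vertex T)" and v': "v' \<in> neighbours T (root_vertex T)"
    and "v \<noteq> v'"
  shows "verts (branch T v) \<inter> verts (branch T v') = {}"
proof (rule ccontr)
  let ?r = "root_vertex T"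
  assume "\<not> ?thesis"
  then obtain w where "(v, w) \<in> (adjacency {e \<in> edges T. ?r \<notin> e})\<^sup>*"
    and "(v', w) \<in> (adjacency {e \<in> edges T. ?r \<notin> e})\<^sup>*"
    by (auto simp: verts_branch)
  then have "(v, v') \<in> (adjacency {e \<in> edges T. ?r \<notin> e})\<^sup>*"
    by (rule rtrancl_trans[OF _ reachable_sym])
  moreover have "{e \<in> edges T. ?r \<notin> e} \<subseteq> edges T - {{?r, v'}}"
    by auto
  ultimately have "(v, v') \<in> (adjacency (edges T - {{?r, v'}}))\<^sup>*"
    using adjacency_mono by blast
  moreover have "(?r, v) \<in> adjacency (edges T - {{?r, v'}})"
    using v \<open>v \<noteq> v'\<close> by (auto simp: in_adjacency neighbours_def doubleton_eq_iff)
  ultimately have "(?r, v') \<in> (adjacency (edges T - {{?r, v'}}))\<^sup>*"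
    by (rule converse_rtrancl_into_rtrancl[rotated])
  then show False
    using v' tree by (auto simp: rooted_tree_iff neighbours_def)
qed

lemma degree_root: "degree T (root_vertex T) = card (neighbours T (root_vertex T))"
proof -
  let ?r = "root_vertex T"
  have "{e \<in> edges T. ?r \<in> e} = (\<lambda>w. {?r, w}) ` neighbours T ?r"
    using tree_edge_at by (fastforce simp: neighbours_def)
  moreover have "inj_on (\<lambda>w. {?r, w}) (neighbours T ?r)"
    by (auto simp: inj_on_def doubleton_eq_iff)
  ultimately show ?thesis
    by (simp add: degree_def card_image)
qed

text \<open>The only edge of \<open>T\<close> that leaves a branch is the one from its root to the root
  of \<open>T\<close>: another edge from the root into the branch would start a second branch that meets
  this one.\<close>

lemma degree_in_branch:
  assumes v: "v \<in> neighbours T (root_vertex T)" and w: "w \<in> verts (branch T v)"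
  shows "degree T w = degree (branch T v) w + (if w = v then 1 else 0)"
proof -
  let ?r = "root_vertex T"
  let ?B = "{e \<in> edges (branch T v). w \<in> e}"
  have avoid: "{e \<in> edges T. w \<in> e \<and> ?r \<notin> e} = ?B"
  proof -
    have "e \<in> ?B" if e: "e \<in> edges T" "w \<in> e" "?r \<notin> e" for e
    proof -
      obtain x where "e = {w, x}"
        using tree_edge_at[OF e(1,2)] by blast
      with e w branch_closed[OF w, of x] show ?thesis
        by (auto simp: edges_branch)
    qed
    then show ?thesis
      by (auto simp: edges_branch)
  qed
  have through: "{e \<in> edges T. w \<in> e \<and> ?r \<in> e} = (if w = v then {{?r, v}} else {})"
  proof -
    have "w \<noteq> ?r"
      using verts_branch_subset[OF v] w by blast
    have only: "e = {?r, v} \<and> w = v" if "e \<in> edges T" "w \<in> e" "?r \<in> e" for e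
    proof -
      have e: "e = {?r, w}"
        using tree_edge[OF that(1)] that(2,3) \<open>w \<noteq> ?r\<close> by (auto simp: card_2_iff)
      then have "w \<in> neighbours T ?r"
        using that(1) by (simp add: neighbours_def)
      then have "w = v"
        using branches_disjoint[OF v] w root_in_branch[of w T] by blast
      with e show ?thesis by simp
    qed
    have "{?r, v} \<in> edges T"
      using v by (simp add: neighbours_def)
    then have "e \<in> edges T \<and> w \<in> e \<and> ?r \<in> e \<longleftrightarrow> w = v \<and> e = {?r, v}" for e
      using only[of e] by blast
    then show ?thesis
      by simp
  qed
  have "{e \<in> edges T. w \<in> e} =
      {e \<in> edges T. w \<in> e \<and> ?r \<notin> e} \<union> {e \<in> edges T. w \<in> e \<and> ?r \<in> e}"
    by blast
  then have "{e \<in> edges T. w \<in> e} = ?B \<union> (if w = v then {{?r, v}} else {})"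
    by (simp only: avoid through)
  moreover have "finite ?B"
    using finite_verts_branch[OF v]
    by (auto simp: edges_branch intro: finite_subset[of _ "Pow (verts (branch T v))"])
  moreover have "{?r, v} \<notin> edges (branch T v)"
    by (simp add: edges_branch)
  ultimately show ?thesis
    by (cases "w = v") (simp_all add: degree_def)
qed

end

section \<open>Prime indices and the Matula number\<close>

lemma prime_nth_prime: "prime (nth_prime m)"
  using enumerate_in_set[OF primes_infinite] by (auto simp: nth_prime_def)

text \<open>The inverse of \<^const>\<open>nth_prime\<close> on primes, with indices starting at 1.\<close>

definition prime_index :: "nat \<Rightarrow> nat" where
  "prime_index p = Suc (card {q. prime q \<and> q < p})"

text \<open>The primes below \<open>p\<close> lie among the \<open>p - 2\<close> numbers from 2 to \<open>p - 1\<close>.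
  The strict inequality makes recursion and induction along prime indices well-founded.\<close>

lemma prime_index_less:
  assumes "prime p"
  shows "prime_index p < p"
proof -
  have "card {q. prime q \<and> q < p} \<le> card {2..<p}"
    by (rule card_mono) (auto simp: prime_ge_2_nat)
  then show ?thesis
    using prime_ge_2_nat[OF assms] by (simp add: prime_index_def)
qed

lemma prime_index_nth_prime:
  assumes "m \<ge> 1"
  shows "prime_index (nth_prime m) = m"
proof -
  let ?P = "{q::nat. prime q}"
  note inf = primes_infinite
  have "{q. prime q \<and> q < enumerate ?P (m - 1)} = enumerate ?P ` {..<m - 1}"
  proof (intro equalityI subsetI)
    fix q
    assume q: "q \<in> {q. prime q \<and> q < enumerate ?P (m - 1)}"
    then obtain j where "enumerate ?P j = q"
      using enumerate_Ex[OF inf] by blast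
    with q show "q \<in> enumerate ?P ` {..<m - 1}"
      using inf by auto
  qed (use inf enumerate_in_set[OF inf] in auto)
  moreover have "inj (enumerate ?P)"
    using inf by (rule inj_enumerate)
  ultimately show ?thesis
    using assms by (simp add: prime_index_def nth_prime_def card_image inj_on_subset)
qed

lemma nth_prime_prime_index:
  assumes "prime p"
  shows "nth_prime (prime_index p) = p"
proof -
  obtain j where "enumerate {q. prime q} j = p"
    using enumerate_Ex[OF primes_infinite] assms by blast
  then have "p = nth_prime (Suc j)"
    by (simp add: nth_prime_def)
  then show ?thesis
    by (simp add: prime_index_nth_prime)
qed

lemma nth_prime_1: "nth_prime 1 = 2"
proof -
  have "{q::nat. prime q \<and> q < 2} = {}"
    by (auto dest: prime_ge_2_nat)
  then have "prime_index 2 = 1"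
    by (simp only: prime_index_def) simp
  then show ?thesis
    using nth_prime_prime_index[of 2] by simp
qed

lemma matula_tree:
  "rooted_tree T \<Longrightarrow>
    matula T = (\<Prod>v\<in>neighbours T (root_vertex T). nth_prime (matula (branch T v)))"
  by (simp add: matula.simps)

lemma matula_pos: "rooted_tree T \<Longrightarrow> matula T \<ge> 1"
  by (simp add: matula_tree Suc_le_eq prod_pos prime_gt_0_nat[OF prime_nth_prime])

text \<open>Branches with equal Matula numbers give the same prime, hence a multiset image.\<close>

lemma prime_factorization_matula:
  assumes "rooted_tree T"
  shows "prime_factorization (matula T) =
    image_mset (\<lambda>v. nth_prime (matula (branch T v))) (mset_set (neighbours T (root_vertex T)))"
proof -
  have "matula T = prod_mset (image_mset (\<lambda>v. nth_prime (matula (branch T v)))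
      (mset_set (neighbours T (root_vertex T))))"
    by (simp add: matula_tree assms prod_unfold_prod_mset)
  then show ?thesis
    by (simp only:) (rule prime_factorization_prod_mset_primes, auto simp: prime_nth_prime)
qed

lemma degree_root_eq_big_omega:
  "rooted_tree T \<Longrightarrow> degree T (root_vertex T) = big_omega (matula T)"
  by (simp add: big_omega_def prime_factorization_matula degree_root)

section \<open>The product of the degrees of the non-root vertices\<close>

text \<open>The completely multiplicative function whose value at the \<open>t\<close>-th prime is the
  degree product of a branch with Matula number \<open>t\<close>; the summand 1 counts the edge from the
  branch to the root of the whole tree.\<close>

function nonroot_product :: "nat \<Rightarrow> nat" where
  "nonroot_product n = (\<Prod>p\<in>#prime_factorization n.
     nonroot_product (prime_index p) * (big_omega (prime_index p) + 1))"
  by pat_completeness auto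
termination
proof (relation "measure id")
  fix n p :: nat
  assume "p \<in># prime_factorization n"
  then have "prime p" "p \<le> n"
    by (auto simp: in_prime_factors_iff dvd_imp_le)
  then show "(prime_index p, n) \<in> measure id"
    using prime_index_less[of p] by simp
qed simp

declare nonroot_product.simps [simp del]

lemma nonroot_product_1: "nonroot_product 1 = 1"
  by (subst nonroot_product.simps) (simp del: One_nat_def)

lemma nonroot_product_mult:
  assumes "r \<ge> 1" "s \<ge> 1"
  shows "nonroot_product (r * s) = nonroot_product r * nonroot_product s"
  using assms
  by (simp add: nonroot_product.simps[of "r * s"] nonroot_product.simps[of r]
      nonroot_product.simps[of s] prime_factorization_mult)

lemma nonroot_product_nth_prime:
  assumes "t \<ge> 1"
  shows "nonroot_product (nth_prime t) = nonroot_product t * (big_omega t + 1)"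
  using assms
  by (simp add: nonroot_product.simps[of "nth_prime t"] prime_factorization_prime prime_nth_prime
      prime_index_nth_prime)

text \<open>Induction over branches: a branch contributes the degree product of its own non-root
  vertices, times the degree of its root in the whole tree, which is one more than its degree in the
  branch.\<close>

lemma prod_degree_nonroot:
  "rooted_tree T \<Longrightarrow> (\<Prod>w\<in>verts T - {root_vertex T}. degree T w) = nonroot_product (matula T)"
proof (induction T rule: matula.induct)
  case (1 T)
  let ?N = "neighbours T (root_vertex T)"
  let ?m = "\<lambda>v. matula (branch T v)"
  note tree = \<open>rooted_tree T\<close>
  have inner: "(\<Prod>w\<in>verts (branch T v). degree T w) = nonroot_product (?m v) * (big_omega (?m v) + 1)"
    if v: "v \<in> ?N" for v
  proof -
    note treev = rooted_tree_branch[OF tree v]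
    have "(\<Prod>w\<in>verts (branch T v). degree T w) =
        degree T v * (\<Prod>w\<in>verts (branch T v) - {v}. degree T w)"
      using finite_verts_branch[OF tree v] root_in_branch by (rule prod.remove)
    also have "(\<Prod>w\<in>verts (branch T v) - {v}. degree T w) =
        (\<Prod>w\<in>verts (branch T v) - {v}. degree (branch T v) w)"
      by (rule prod.cong) (auto simp: degree_in_branch[OF tree v])
    also have "\<dots> = nonroot_product (?m v)"
      using "1.IH"[OF tree v treev] by simp
    also have "degree T v = big_omega (?m v) + 1"
      using degree_in_branch[OF tree v root_in_branch] degree_root_eq_big_omega[OF treev] by simp
    finally show ?thesis
      by simp
  qed
  have "(\<Prod>w\<in>verts T - {root_vertex T}. degree T w) =
      (\<Prod>v\<in>?N. \<Prod>w\<in>verts (branch T v). degree T w)"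
    unfolding verts_eq_Union_branches[OF tree]
    by (rule prod.UNION_disjoint)
      (use finite_neighbours_root[OF tree] finite_verts_branch[OF tree]
        branches_disjoint[OF tree] in blast)+
  also have "\<dots> = (\<Prod>v\<in>?N. nonroot_product (?m v) * (big_omega (?m v) + 1))"
    by (rule prod.cong) (auto simp: inner)
  also have "\<dots> = (\<Prod>v\<in>?N. nonroot_product (prime_index (nth_prime (?m v))) *
      (big_omega (prime_index (nth_prime (?m v))) + 1))"
    by (intro prod.cong refl)
      (simp only: prime_index_nth_prime[OF matula_pos[OF rooted_tree_branch[OF tree]]])
  also have "\<dots> = nonroot_product (matula T)"
    by (simp add: nonroot_product.simps[of "matula T"] prime_factorization_matula[OF tree]
        prod_unfold_prod_mset image_mset.compositionality comp_def)
  finally show ?case .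
qed

lemma narumi_katayama_eq:
  assumes tree: "rooted_tree T"
  shows "narumi_katayama T = big_omega (matula T) * nonroot_product (matula T)"
proof -
  have "narumi_katayama T =
      degree T (root_vertex T) * (\<Prod>w\<in>verts T - {root_vertex T}. degree T w)"
    unfolding narumi_katayama_def
    using tree by (intro prod.remove) (auto simp: rooted_tree_iff simple_graph_def)
  then show ?thesis
    by (simp add: prod_degree_nonroot[OF tree] degree_root_eq_big_omega[OF tree])
qed

section \<open>Every positive integer is a Matula number\<close>

text \<open>The tree \<open>A\<close> is hung below the root of \<open>B\<close> as an additional branch, which
  multiplies the Matula number of \<open>B\<close> by one prime.\<close>

definition attach :: "'a rooted_graph \<Rightarrow> 'a rooted_graph \<Rightarrow> 'a rooted_graph" where
  "attach A B = \<lparr>verts = verts A \<union> verts B,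
     edges = insert {root_vertex A, root_vertex B} (edges A \<union> edges B),
     root_vertex = root_vertex B\<rparr>"

lemma attach_sel [simp]:
  "verts (attach A B) = verts A \<union> verts B"
  "edges (attach A B) = insert {root_vertex A, root_vertex B} (edges A \<union> edges B)"
  "root_vertex (attach A B) = root_vertex B"
  by (simp_all add: attach_def)

text \<open>A detour from \<open>u\<close> to \<open>v\<close> may enter \<open>B\<close>, but only through the root of
  \<open>A\<close>, to which it must return. Sending every vertex of \<open>B\<close> to that root therefore turns the
  detour into one inside \<open>A\<close>, where \<open>{u, v}\<close> is a bridge. The edge set is a separate
  variable so that the lemma also applies with \<open>A\<close> and \<open>B\<close> interchanged.\<close>

lemma attach_edge_bridge:
  assumes A: "rooted_tree A" and B: "rooted_tree B" and disj: "verts A \<inter> verts B = {}"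
    and uv: "{u, v} \<in> edges A"
    and E: "E = insert {root_vertex A, root_vertex B} (edges A \<union> edges B)"
  shows "(u, v) \<notin> (adjacency (E - {{u, v}}))\<^sup>*"
proof
  let ?a = "root_vertex A" and ?b = "root_vertex B"
  let ?R = "(adjacency (edges A - {{u, v}}))\<^sup>*"
  note edgeA = tree_edge[OF A] and edgeB = tree_edge[OF B]
  have roots: "?a \<in> verts A" "?b \<in> verts B"
    using A B by (auto simp: rooted_tree_iff)
  have "(w \<in> verts A \<longrightarrow> (u, w) \<in> ?R) \<and> (w \<in> verts B \<longrightarrow> (u, ?a) \<in> ?R)"
    if "(u, w) \<in> (adjacency (E - {{u, v}}))\<^sup>*" for w
    using that
  proof (induction rule: rtrancl_induct)
    case base
    then show ?case using edgeA[OF uv] disj by auto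
  next
    case (step y z)
    then consider "{y, z} \<in> edges A - {{u, v}}" | "{y, z} = {?a, ?b}" | "{y, z} \<in> edges B"
      by (auto simp: in_adjacency E)
    then show ?case
    proof cases
      case 1
      then have "(y, z) \<in> adjacency (edges A - {{u, v}})" "y \<in> verts A" "z \<in> verts A"
        using edgeA[of "{y, z}"] by (auto simp: in_adjacency)
      then show ?thesis
        using step.IH disj by (auto intro: rtrancl_into_rtrancl)
    next
      case 2
      then show ?thesis
        using step.IH disj roots by (auto simp: doubleton_eq_iff)
    next
      case 3
      then show ?thesis
        using step.IH disj edgeB[of "{y, z}"] by auto
    qed
  qed
  moreover assume "(u, v) \<in> (adjacency (E - {{u, v}}))\<^sup>*"
  ultimately have "(u, v) \<in> ?R"
    using edgeA[OF uv] by simp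
  then show False
    using A uv by (simp add: rooted_tree_iff)
qed

lemma rooted_tree_attach:
  assumes A: "rooted_tree A" and B: "rooted_tree B" and disj: "verts A \<inter> verts B = {}"
  shows "rooted_tree (attach A B)"
proof -
  let ?a = "root_vertex A" and ?b = "root_vertex B"
  let ?E = "insert {?a, ?b} (edges A \<union> edges B)"
  note edgeA = tree_edge[OF A] and edgeB = tree_edge[OF B]
  have roots: "?a \<in> verts A" "?b \<in> verts B" "?a \<noteq> ?b"
    using A B disj by (auto simp: rooted_tree_iff)
  have "(?b, w) \<in> (adjacency ?E)\<^sup>*" if "w \<in> verts A \<union> verts B" for w
  proof (cases "w \<in> verts A")
    case True
    then have "(?a, w) \<in> (adjacency (edges A))\<^sup>*"
      using A roots by (auto simp: rooted_tree_iff connected_graph_def)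
    then have "(?a, w) \<in> (adjacency ?E)\<^sup>*"
      using adjacency_mono[of "edges A" ?E] by blast
    moreover have "(?b, ?a) \<in> adjacency ?E"
      by (simp add: in_adjacency insert_commute)
    ultimately show ?thesis
      by (rule converse_rtrancl_into_rtrancl[rotated])
  next
    case False
    then have "(?b, w) \<in> (adjacency (edges B))\<^sup>*"
      using that B roots by (auto simp: rooted_tree_iff connected_graph_def)
    then show ?thesis
      using adjacency_mono[of "edges B" ?E] by blast
  qed
  then have "(u, v) \<in> (adjacency ?E)\<^sup>*" if "u \<in> verts A \<union> verts B" "v \<in> verts A \<union> verts B" for u v
    using that by (blast intro: rtrancl_trans reachable_sym)
  then have "connected_graph (attach A B)"
    by (simp add: connected_graph_def)
  moreover have "simple_graph (attach A B)"
    using A B roots edgeA edgeB by (auto simp: rooted_tree_iff simple_graph_def)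
  moreover have "(u, v) \<notin> (adjacency (?E - {{u, v}}))\<^sup>*" if uv: "{u, v} \<in> ?E" for u v
  proof -
    consider "{u, v} = {?a, ?b}" | "{u, v} \<in> edges A" | "{u, v} \<in> edges B"
      using uv by blast
    then show ?thesis
    proof cases
      case 1
      have sub: "?E - {{u, v}} \<subseteq> edges A \<union> edges B"
        using 1 by blast
      have ab: "(?a, ?b) \<notin> (adjacency (edges A \<union> edges B))\<^sup>*"
        using reachable_Un_disjoint[of ?a ?b "edges A" "edges B" "verts A"] roots disj edgeA edgeB
        by blast
      then have "(?b, ?a) \<notin> (adjacency (edges A \<union> edges B))\<^sup>*"
        using reachable_sym[of ?b ?a "edges A \<union> edges B"] by blast
      with ab 1 have "(u, v) \<notin> (adjacency (edges A \<union> edges B))\<^sup>*"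
        by (auto simp: doubleton_eq_iff)
      then show ?thesis
        using adjacency_mono[OF sub] by blast
    next
      case 2
      show ?thesis
        using attach_edge_bridge[OF A B disj 2 refl] .
    next
      case 3
      have "verts B \<inter> verts A = {}"
        using disj by blast
      then show ?thesis
        using attach_edge_bridge[OF B A _ 3, of ?E] by (simp add: insert_commute Un_commute)
    qed
  qed
  ultimately show ?thesis
    using roots by (simp add: rooted_tree_iff)
qed

lemma branch_attach_new:
  assumes A: "rooted_tree A" and B: "rooted_tree B" and disj: "verts A \<inter> verts B = {}"
  shows "branch (attach A B) (root_vertex A) = A"
proof -
  let ?a = "root_vertex A" and ?b = "root_vertex B"
  let ?F = "{e \<in> edges B. ?b \<notin> e}"
  note edgeA = tree_edge[OF A] and edgeB = tree_edge[OF B]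
  have roots: "?a \<in> verts A" "?b \<in> verts B" "?b \<notin> verts A"
    using A B disj by (auto simp: rooted_tree_iff)
  have E: "{e \<in> edges (attach A B). ?b \<notin> e} = edges A \<union> ?F"
    using edgeA roots by auto
  have "(?a, w) \<in> (adjacency (edges A \<union> ?F))\<^sup>* \<longleftrightarrow> w \<in> verts A" for w
  proof
    assume "(?a, w) \<in> (adjacency (edges A \<union> ?F))\<^sup>*"
    then show "w \<in> verts A"
      using reachable_Un_disjoint[of ?a w "edges A" ?F "verts A"] roots edgeA edgeB disj by blast
  next
    assume "w \<in> verts A"
    then have "(?a, w) \<in> (adjacency (edges A))\<^sup>*"
      using A roots by (simp add: rooted_tree_iff connected_graph_def)
    then show "(?a, w) \<in> (adjacency (edges A \<union> ?F))\<^sup>*"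
      using adjacency_mono[of "edges A" "edges A \<union> ?F"] by blast
  qed
  then have V: "verts (branch (attach A B) ?a) = verts A"
    unfolding verts_branch using E by simp
  have "e \<notin> edges B" if "e \<subseteq> verts A" for e
    using edgeB[of e] that disj by (cases "e = {}") auto
  then have "edges (branch (attach A B) ?a) = edges A"
    unfolding edges_branch V using edgeA roots by auto
  with V show ?thesis
    by (intro rooted_graph.equality) simp_all
qed

lemma branch_attach_old:
  assumes A: "rooted_tree A" and B: "rooted_tree B" and disj: "verts A \<inter> verts B = {}"
    and v: "v \<in> neighbours B (root_vertex B)"
  shows "branch (attach A B) v = branch B v"
proof -
  let ?b = "root_vertex B"
  let ?F = "{e \<in> edges B. ?b \<notin> e}"
  note edgeA = tree_edge[OF A] and edgeB = tree_edge[OF B]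
  have roots: "?b \<in> verts B" "?b \<notin> verts A" "v \<in> verts B"
    using A B disj neighbours_root_subset[OF B] v by (auto simp: rooted_tree_iff)
  have E: "{e \<in> edges (attach A B). ?b \<notin> e} = ?F \<union> edges A"
    using edgeA roots by auto
  have "(v, w) \<in> (adjacency (?F \<union> edges A))\<^sup>* \<longleftrightarrow> (v, w) \<in> (adjacency ?F)\<^sup>*" for w
    using reachable_Un_disjoint[of v w ?F "edges A" "verts B"] roots edgeA edgeB disj
      adjacency_mono[of ?F "?F \<union> edges A"]
    by blast
  then have V: "verts (branch (attach A B) v) = verts (branch B v)"
    unfolding verts_branch using E by simp
  have "e \<notin> edges A" if "e \<subseteq> verts B" for e
    using edgeA[of e] that disj by (cases "e = {}") auto
  then have "edges (branch (attach A B) v) = edges (branch B v)"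
    unfolding edges_branch V using verts_branch_subset[OF B v] by auto
  with V show ?thesis
    by (intro rooted_graph.equality) simp_all
qed

lemma matula_attach:
  assumes A: "rooted_tree A" and B: "rooted_tree B" and disj: "verts A \<inter> verts B = {}"
  shows "matula (attach A B) = nth_prime (matula A) * matula B"
proof -
  let ?a = "root_vertex A" and ?b = "root_vertex B"
  have roots: "?a \<in> verts A" "?b \<in> verts B" "?a \<notin> verts B" "?b \<notin> verts A"
    using A B disj by (auto simp: rooted_tree_iff)
  have N: "neighbours (attach A B) ?b = insert ?a (neighbours B ?b)"
    using roots tree_edge[OF A] by (auto simp: neighbours_def doubleton_eq_iff)
  have "?a \<notin> neighbours B ?b"
    using neighbours_root_subset[OF B] roots by blast
  then show ?thesis
    using finite_neighbours_root[OF B]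
    by (simp add: matula_tree[OF rooted_tree_attach[OF assms]] N branch_attach_new[OF assms]
        branch_attach_old[OF assms] matula_tree[OF B])
qed

lemma singleton_rooted_tree:
  fixes a :: 'a
  defines "T \<equiv> \<lparr>verts = {a}, edges = {}, root_vertex = a\<rparr>"
  shows "rooted_tree T" "matula T = 1"
proof -
  show "rooted_tree T"
    by (simp add: T_def rooted_tree_iff simple_graph_def connected_graph_def)
  then show "matula T = 1"
    by (simp add: matula_tree) (simp add: T_def neighbours_def)
qed

text \<open>Confining the vertices to an arbitrary infinite set lets the second tree avoid the
  vertices of the first, so that no renaming of vertices is needed to make the two disjoint.\<close>

lemma rooted_tree_with_matula_exists:
  fixes S :: "'a set"
  assumes "n \<ge> 1" "infinite S"
  shows "\<exists>T. rooted_tree T \<and> verts T \<subseteq> S \<and> matula T = n"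
  using assms
proof (induction n arbitrary: S rule: less_induct)
  case (less n)
  show ?case
  proof (cases "n = 1")
    case True
    obtain a where "a \<in> S"
      using less.prems(2) infinite_imp_nonempty by blast
    with True singleton_rooted_tree[of a] show ?thesis
      by (intro exI[of _ "\<lparr>verts = {a}, edges = {}, root_vertex = a\<rparr>"]) simp
  next
    case False
    then obtain p m where p: "prime p" and n: "n = p * m"
      using prime_factor_nat by (metis dvdE)
    have m: "m \<ge> 1" "m < n"
      using less.prems(1) n prime_gt_1_nat[OF p] by auto
    have "p \<le> n"
      using m n by simp
    then have t: "prime_index p \<ge> 1" "prime_index p < n"
      using prime_index_less[OF p] by (auto simp: prime_index_def)
    obtain A :: "'a rooted_graph" where A: "rooted_tree A" "verts A \<subseteq> S" "matula A = prime_index p"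
      using less.IH[OF t(2,1) less.prems(2)] by blast
    have "infinite (S - verts A)"
      using A(1) less.prems(2) by (simp add: rooted_tree_iff simple_graph_def)
    then obtain B where B: "rooted_tree B" "verts B \<subseteq> S - verts A" "matula B = m"
      using less.IH[OF m(2,1)] by blast
    have disj: "verts A \<inter> verts B = {}"
      using B(2) by blast
    show ?thesis
      using rooted_tree_attach[OF A(1) B(1) disj] matula_attach[OF A(1) B(1) disj] A B n
      by (intro exI[of _ "attach A B"]) (auto simp: nth_prime_prime_index[OF p])
  qed
qed

lemma NK_eq:
  assumes "n \<ge> 1"
  shows "NK n = big_omega n * nonroot_product n"
proof -
  have "\<exists>T::nat rooted_graph. rooted_tree T \<and> matula T = n"
    using rooted_tree_with_matula_exists[OF assms infinite_UNIV_nat] by blast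
  then have "rooted_tree (tau n) \<and> matula (tau n) = n"
    unfolding tau_def by (rule someI_ex)
  then show ?thesis
    using narumi_katayama_eq[of "tau n"] by (simp add: NK_def)
qed

section \<open>The recursion for the Narumi-Katayama index\<close>

lemma big_omega_1: "big_omega 1 = 0"
  by (simp add: big_omega_def)

lemma big_omega_nth_prime: "big_omega (nth_prime t) = 1"
  by (simp add: big_omega_def prime_factorization_prime prime_nth_prime)

lemma big_omega_mult: "r \<ge> 1 \<Longrightarrow> s \<ge> 1 \<Longrightarrow> big_omega (r * s) = big_omega r + big_omega s"
  by (simp add: big_omega_def prime_factorization_mult)

lemma big_omega_pos: "n \<ge> 2 \<Longrightarrow> big_omega n > 0"
  by (auto simp: big_omega_def prime_factorization_empty_iff nonempty_has_size[symmetric])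

theorem proposition3p21:
  fixes n :: nat
  assumes "n \<ge> 1"
  shows "(n = 1 \<longrightarrow> NK n = 0) \<and>
    (n = 2 \<longrightarrow> NK n = 1) \<and>
    (\<forall>t\<ge>2. n = nth_prime t \<longrightarrow>
      real (NK n) = real (NK t) * (1 + 1 / real (big_omega t))) \<and>
    (\<forall>r\<ge>2. \<forall>s\<ge>2. n = r * s \<longrightarrow>
      real (NK n) = real (NK r) * real (NK s) *
        (1 / real (big_omega r) + 1 / real (big_omega s)))"
proof (intro conjI impI allI)
  assume "n = 1"
  then show "NK n = 0"
    using NK_eq[of 1] big_omega_1 by simp
next
  assume "n = 2"
  then have "n = nth_prime 1"
    using nth_prime_1 by simp
  then show "NK n = 1"
    using assms nonroot_product_nth_prime[of 1] nonroot_product_1 big_omega_1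
    by (simp add: NK_eq big_omega_nth_prime)
next
  fix t :: nat
  assume t: "t \<ge> 2" and n: "n = nth_prime t"
  have "NK n = nonroot_product t * (big_omega t + 1)"
    using assms t n by (simp add: NK_eq big_omega_nth_prime nonroot_product_nth_prime)
  moreover have "NK t = big_omega t * nonroot_product t"
    using t by (simp add: NK_eq)
  ultimately show "real (NK n) = real (NK t) * (1 + 1 / real (big_omega t))"
    using big_omega_pos[OF t] by (simp add: field_simps)
next
  fix r s :: nat
  assume r: "r \<ge> 2" and s: "s \<ge> 2" and n: "n = r * s"
  have "NK n = (big_omega r + big_omega s) * (nonroot_product r * nonroot_product s)"
    using assms r s n by (simp add: NK_eq big_omega_mult nonroot_product_mult)
  moreover have "NK r = big_omega r * nonroot_product r" "NK s = big_omega s * nonroot_product s"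
    using r s by (simp_all add: NK_eq)
  ultimately show "real (NK n) = real (NK r) * real (NK s) *
      (1 / real (big_omega r) + 1 / real (big_omega s))"
    using big_omega_pos[OF r] big_omega_pos[OF s] by (simp add: field_simps)
qed

end
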